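(* Let $G$ be a graph with minimum degree $\delta(G)\ge 7$. Then $\mathcal F_{\mathrm{str}}(G)=\mathcal F(G)$. That is to say, every Y-$\Delta$ move on any $H\in\mathcal F(G)$ is automatically strong: for every $H\in\mathcal F(G)$ and every vertex $x$ of degree $3$ in $H$, the three neighbours of $x$ are pairwise non-adjacent in $H$.
   Context: A graph is a finite simple undirected graph. A triangle is a 3-cycle. A $\Delta$-Y move on a graph $H$ at a triangle $T\subset H$ removes the three edges of $T$ and adds a new vertex adjacent to exactly the three vertices of $T$. A Y-$\Delta$ move on $H$ at a vertex $x$ of degree $3$ removes $x$ and adds those edges among the three neighbours of $x$ that are missing, so that the neighbours form a triangle (the graph stays simple). A Y-$\Delta$ move at $x$ is strong if the neighbourhood of $x$ is an independent set of size $3$. $\mathcal F(G)$ is the family of graphs obtainable from $G$ by a finite (possibly empty) sequence of $\Delta$-Y or Y-$\Delta$ moves. $\mathcal F_{\mathrm{str}}(G)$ is the family of graphs obtainable from $G$ by a finite (possibly empty) sequence of $\Delta$-Y or strong Y-$\Delta$ moves. Labelling convention. Moves keep the names of surviving vertices, and the vertex added by a $\Delta$-Y move is given a fresh name (not in $V(G)$ and not used in any earlier graph of the sequence). Two graphs obtained from $G$ that differ only by renaming vertices not in $V(G)$ are regarded as the same. *)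

theory Defs
  imports "HOL-Library.Infinite_Typeclass"
begin

record 'a ugraph =
  verts :: "'a set"
  edges :: "'a set set"

definition pairs :: "'a set \<Rightarrow> 'a set set" where
  "pairs S = {{u, v} | u v. u \<in> S \<and> v \<in> S \<and> u \<noteq> v}"

definition graph :: "'a ugraph \<Rightarrow> bool" where
  "graph H \<longleftrightarrow> finite (verts H) \<and> edges H \<subseteq> pairs (verts H)"

definition nbhd :: "'a ugraph \<Rightarrow> 'a \<Rightarrow> 'a set" where
  "nbhd H x = {v. {x, v} \<in> edges H}"

definition degree :: "'a ugraph \<Rightarrow> 'a \<Rightarrow> nat" where
  "degree H x = card (nbhd H x)"

text \<open>The value is unspecified for the graph without vertices.\<close>

definition min_degree :: "'a ugraph \<Rightarrow> nat" where
  "min_degree H = Min (degree H ` verts H)"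

definition independent :: "'a ugraph \<Rightarrow> 'a set \<Rightarrow> bool" where
  "independent H S \<longleftrightarrow> S \<subseteq> verts H \<and> (\<forall>u\<in>S. \<forall>v\<in>S. {u, v} \<notin> edges H)"

text \<open>A triangle of a simple graph is determined by its vertex set \<open>T\<close>; its edges are \<open>pairs T\<close>.\<close>

definition triangle :: "'a ugraph \<Rightarrow> 'a set \<Rightarrow> bool" where
  "triangle H T \<longleftrightarrow> T \<subseteq> verts H \<and> card T = 3 \<and> pairs T \<subseteq> edges H"

definition delta_Y :: "'a ugraph \<Rightarrow> 'a set \<Rightarrow> 'a \<Rightarrow> 'a ugraph" where
  "delta_Y H T y =
     \<lparr>verts = insert y (verts H),
      edges = (edges H - pairs T) \<union> {{y, v} | v. v \<in> T}\<rparr>"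

definition Y_delta :: "'a ugraph \<Rightarrow> 'a \<Rightarrow> 'a ugraph" where
  "Y_delta H x =
     \<lparr>verts = verts H - {x},
      edges = {e \<in> edges H. x \<notin> e} \<union> pairs (nbhd H x)\<rparr>"

definition Y_delta_at :: "'a ugraph \<Rightarrow> 'a \<Rightarrow> bool" where
  "Y_delta_at H x \<longleftrightarrow> x \<in> verts H \<and> degree H x = 3"

definition strong_Y_delta_at :: "'a ugraph \<Rightarrow> 'a \<Rightarrow> bool" where
  "strong_Y_delta_at H x \<longleftrightarrow>
     Y_delta_at H x \<and> independent H (nbhd H x) \<and> card (nbhd H x) = 3"

text \<open>
  \<open>obtainable P G U H\<close>: some sequence of \<open>\<Delta>\<close>-Y moves and of Y-\<open>\<Delta>\<close> moves at vertices
  allowed by \<open>P\<close> leads from \<open>G\<close> to \<open>H\<close>, and \<open>U\<close> is the set of all vertex names occurring in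
  the graphs of that sequence (including \<open>G\<close>), so that a fresh name is one outside \<open>U\<close>.
\<close>

inductive obtainable ::
  "('a ugraph \<Rightarrow> 'a \<Rightarrow> bool) \<Rightarrow> 'a ugraph \<Rightarrow> 'a set \<Rightarrow> 'a ugraph \<Rightarrow> bool"
  for P :: "'a ugraph \<Rightarrow> 'a \<Rightarrow> bool" and G :: "'a ugraph" where
  start: "obtainable P G (verts G) G"
| delta_Y: "obtainable P G U H \<Longrightarrow> triangle H T \<Longrightarrow> y \<notin> U
    \<Longrightarrow> obtainable P G (insert y U) (delta_Y H T y)"
| Y_delta: "obtainable P G U H \<Longrightarrow> P H x \<Longrightarrow> obtainable P G U (Y_delta H x)"

text \<open>Graphs that differ only by renaming vertices outside \<open>verts G\<close>.\<close>

definition renaming :: "'a ugraph \<Rightarrow> ('a ugraph \<times> 'a ugraph) set" where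
  "renaming G = {(H, H'). graph H \<and> graph H' \<and>
     (\<exists>f. bij_betw f (verts H) (verts H') \<and> edges H' = (\<lambda>e. f ` e) ` edges H \<and>
          (\<forall>v\<in>verts H. if v \<in> verts G then f v = v else f v \<notin> verts G))}"

text \<open>The families consist of classes of graphs modulo such renamings.\<close>

definition family :: "'a ugraph \<Rightarrow> 'a ugraph set set" where
  "family G = {H. \<exists>U. obtainable Y_delta_at G U H} // renaming G"

definition strong_family :: "'a ugraph \<Rightarrow> 'a ugraph set set" where
  "strong_family G = {H. \<exists>U. obtainable strong_Y_delta_at G U H} // renaming G"

lemma equiv_renaming:
  fixes G :: "'a ugraph"
  shows "equiv {H. graph H} (renaming G)"
proof (rule equivI)
  show "renaming G \<subseteq> {H. graph H} \<times> {H. graph H}"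
    by (auto simp: renaming_def)
  show "refl_on {H. graph H} (renaming G)"
  proof (rule refl_onI)
    fix H :: "'a ugraph" assume "H \<in> {H. graph H}"
    moreover have "bij_betw id (verts H) (verts H)" "edges H = (\<lambda>e. id ` e) ` edges H"
      "\<forall>v\<in>verts H. if v \<in> verts G then id v = v else id v \<notin> verts G"
      by simp_all
    ultimately show "(H, H) \<in> renaming G" unfolding renaming_def by blast
  qed
  show "sym (renaming G)"
  proof (rule symI)
    fix H H' assume "(H, H') \<in> renaming G"
    then obtain f where g: "graph H" "graph H'" and b: "bij_betw f (verts H) (verts H')"
      and e: "edges H' = (\<lambda>e. f ` e) ` edges H"
      and v: "\<forall>v\<in>verts H. if v \<in> verts G then f v = v else f v \<notin> verts G"
      by (auto simp: renaming_def)
    define h where "h = inv_into (verts H) f"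
    have hf: "h (f w) = w" if "w \<in> verts H" for w
      using that b by (simp add: h_def bij_betw_def)
    have "h ` f ` e = e" if "e \<in> edges H" for e
    proof -
      have "e \<subseteq> verts H" using that g(1) by (auto simp: graph_def pairs_def)
      then have "h (f w) = w" if "w \<in> e" for w using that hf by blast
      then show ?thesis unfolding image_image by simp
    qed
    then have "edges H = (\<lambda>e. h ` e) ` edges H'"
      unfolding e image_image[of "\<lambda>e. h ` e"] by simp
    moreover have "bij_betw h (verts H') (verts H)"
      unfolding h_def by (rule bij_betw_inv_into[OF b])
    moreover have "if w \<in> verts G then h w = w else h w \<notin> verts G" if "w \<in> verts H'" for w
    proof -
      have "w \<in> f ` verts H" using that bij_betw_imp_surj_on[OF b] by simp
      then obtain u where u: "u \<in> verts H" "w = f u" by (rule imageE)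
      have "h w = u" using hf[OF u(1)] u(2) by simp
      moreover have "if u \<in> verts G then w = u else w \<notin> verts G"
        using v u by blast
      ultimately show ?thesis by (simp split: if_splits)
    qed
    ultimately show "(H', H) \<in> renaming G" using g unfolding renaming_def by blast
  qed
  show "trans (renaming G)"
  proof (rule transI)
    fix A B C assume "(A, B) \<in> renaming G" "(B, C) \<in> renaming G"
    then obtain f h where g: "graph A" "graph C"
      and f: "bij_betw f (verts A) (verts B)" "edges B = (\<lambda>e. f ` e) ` edges A"
        "\<forall>v\<in>verts A. if v \<in> verts G then f v = v else f v \<notin> verts G"
      and h: "bij_betw h (verts B) (verts C)" "edges C = (\<lambda>e. h ` e) ` edges B"
        "\<forall>v\<in>verts B. if v \<in> verts G then h v = v else h v \<notin> verts G"
      by (auto simp: renaming_def)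
    have "bij_betw (h \<circ> f) (verts A) (verts C)" by (rule bij_betw_trans[OF f(1) h(1)])
    moreover have "edges C = (\<lambda>e. (h \<circ> f) ` e) ` edges A"
      unfolding f(2) h(2) by (simp only: image_image o_def)
    moreover have "if v \<in> verts G then (h \<circ> f) v = v else (h \<circ> f) v \<notin> verts G"
      if "v \<in> verts A" for v
    proof -
      have "f v \<in> verts B" using that bij_betwE[OF f(1)] by blast
      then show ?thesis using that f(3) h(3) by (cases "v \<in> verts G") auto
    qed
    ultimately show "(A, C) \<in> renaming G" using g unfolding renaming_def by blast
  qed
qed

end

theory Submission imports Defs begin

text \<open>
  Every graph in the family of \<open>G\<close> arises from \<open>G\<close> by choosing pairwise edge-disjoint triangles
  of \<open>G\<close> and replacing each of them by a Y. This description survives both kinds of move. In such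
  a graph the three neighbours of a new vertex are pairwise non-adjacent, because the three edges
  between them are removed and the edges of all Ys have a new end. So a triangle of the
  new graph avoids the new vertices: it is a triangle of \<open>G\<close> that is edge-disjoint from those already replaced, and
  a \<open>\<Delta>\<close>-Y move just enlarges the choice (\<open>triangle_packing_insert\<close>, \<open>delta_Y_replace\<close>).
  On the other hand, at a vertex of \<open>G\<close> a Y puts one edge in the place of two, so a vertex
  of \<open>G\<close> keeps at least half of its degree (\<open>degree_le_twice_degree_replace\<close>). Degree at least
  \<open>7\<close> in \<open>G\<close> thus leaves degree at least \<open>4\<close>, and every vertex of degree \<open>3\<close> is a new one. A
  Y-\<open>\<Delta>\<close> move at it is strong, and gives back its triangle (\<open>Y_delta_replace\<close>). Finally,
  strength of moves is invariant under renaming.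
\<close>

section \<open>Edges and neighbourhoods\<close>

lemma doubleton_in_pairs_iff: "{u, v} \<in> pairs S \<longleftrightarrow> u \<in> S \<and> v \<in> S \<and> u \<noteq> v"
  by (auto simp: pairs_def doubleton_eq_iff)

lemma graph_edgeD:
  assumes "graph H" and "{u, v} \<in> edges H"
  shows "u \<in> verts H" and "v \<in> verts H" and "u \<noteq> v"
proof -
  have "{u, v} \<in> pairs (verts H)"
    using assms unfolding graph_def by blast
  then show "u \<in> verts H" and "v \<in> verts H" and "u \<noteq> v"
    unfolding doubleton_in_pairs_iff by blast+
qed

lemma graph_edge_cases:
  assumes "graph H" and "e \<in> edges H"
  obtains u v where "e = {u, v}" and "u \<in> verts H" and "v \<in> verts H" and "u \<noteq> v"
  using assms by (auto simp: graph_def pairs_def)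

lemma nbhd_subset_verts: "graph H \<Longrightarrow> nbhd H x \<subseteq> verts H"
  by (auto simp: nbhd_def dest: graph_edgeD)

lemma finite_nbhd: "graph H \<Longrightarrow> finite (nbhd H x)"
  using nbhd_subset_verts finite_subset by (metis graph_def)

section \<open>Replacing edge-disjoint triangles by Ys\<close>

text \<open>
  A family of pairwise edge-disjoint triangles of \<open>G\<close>, indexed by a finite set \<open>N\<close> of names that
  are not vertices of \<open>G\<close>. The index \<open>y\<close> will be the centre of the Y that replaces \<open>\<tau> y\<close>.
\<close>

definition triangle_packing :: "'a ugraph \<Rightarrow> 'a set \<Rightarrow> ('a \<Rightarrow> 'a set) \<Rightarrow> bool" where
  "triangle_packing G N \<tau> \<longleftrightarrow> finite N \<and> N \<inter> verts G = {} \<and> (\<forall>y\<in>N. triangle G (\<tau> y)) \<and>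
     (\<forall>y\<in>N. \<forall>z\<in>N. y \<noteq> z \<longrightarrow> pairs (\<tau> y) \<inter> pairs (\<tau> z) = {})"

text \<open>The graph \<open>G\<close> with the triangle \<open>\<tau> y\<close> replaced by a Y with centre \<open>y\<close>, for all \<open>y \<in> N\<close>.\<close>

definition replace_triangles :: "'a ugraph \<Rightarrow> 'a set \<Rightarrow> ('a \<Rightarrow> 'a set) \<Rightarrow> 'a ugraph" where
  "replace_triangles G N \<tau> =
     \<lparr>verts = verts G \<union> N,
      edges = (edges G - (\<Union>y\<in>N. pairs (\<tau> y))) \<union> {{y, v} | y v. y \<in> N \<and> v \<in> \<tau> y}\<rparr>"

lemma verts_replace [simp]: "verts (replace_triangles G N \<tau>) = verts G \<union> N"
  by (simp add: replace_triangles_def)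

lemma edges_replace:
  "edges (replace_triangles G N \<tau>) =
     (edges G - (\<Union>y\<in>N. pairs (\<tau> y))) \<union> {{y, v} | y v. y \<in> N \<and> v \<in> \<tau> y}"
  by (simp add: replace_triangles_def)

lemma replace_triangles_empty: "replace_triangles G {} \<tau> = G"
  by (simp add: replace_triangles_def)

context
  fixes G :: "'a ugraph" and N :: "'a set" and \<tau> :: "'a \<Rightarrow> 'a set"
  assumes graph: "graph G" and packing: "triangle_packing G N \<tau>"
begin

lemma packing_subset: "y \<in> N \<Longrightarrow> \<tau> y \<subseteq> verts G"
  using packing by (auto simp: triangle_packing_def triangle_def)

lemma packing_disjoint_verts: "y \<in> N \<Longrightarrow> y \<notin> verts G"
  using packing by (auto simp: triangle_packing_def)

lemma edge_replace_iff:
  "{u, v} \<in> edges (replace_triangles G N \<tau>) \<longleftrightarrow>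
     {u, v} \<in> edges G \<and> (\<forall>y\<in>N. {u, v} \<notin> pairs (\<tau> y)) \<or> u \<in> N \<and> v \<in> \<tau> u \<or> v \<in> N \<and> u \<in> \<tau> v"
  by (auto simp: edges_replace doubleton_eq_iff)

lemma graph_replace: "graph (replace_triangles G N \<tau>)"
proof -
  have "{y, v} \<in> pairs (verts G \<union> N)" if "y \<in> N" "v \<in> \<tau> y" for y v
    using that packing_subset[of y] packing_disjoint_verts[of y]
    by (auto simp: doubleton_in_pairs_iff)
  moreover have "pairs (verts G) \<subseteq> pairs (verts G \<union> N)"
    by (auto simp: pairs_def)
  ultimately show ?thesis
    using graph packing by (auto simp: graph_def edges_replace triangle_packing_def)
qed

lemma nbhd_replace_new:
  assumes "y \<in> N"
  shows "nbhd (replace_triangles G N \<tau>) y = \<tau> y"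
  using assms packing_subset packing_disjoint_verts graph_edgeD(1)[OF graph]
  by (fastforce simp: nbhd_def edge_replace_iff)

lemma independent_replace_new:
  assumes "y \<in> N"
  shows "independent (replace_triangles G N \<tau>) (\<tau> y)"
  using assms packing_subset packing_disjoint_verts graph_edgeD(3)[OF graph]
  by (fastforce simp: independent_def edge_replace_iff doubleton_in_pairs_iff)

text \<open>
  Each edge at \<open>v\<close> either survives or lies in a replaced triangle; conversely, an edge at \<open>v\<close> of
  the new graph accounts in this way for at most two edges of \<open>G\<close>.
\<close>

lemma degree_le_twice_degree_replace:
  assumes v: "v \<in> verts G"
  shows "degree G v \<le> 2 * degree (replace_triangles G N \<tau>) v"
proof -
  let ?H = "replace_triangles G N \<tau>"
  define F where "F z = (if z \<in> N then \<tau> z - {v} else {z})" for z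
  have fin: "finite (nbhd ?H v)"
    by (rule finite_nbhd[OF graph_replace])
  have F: "finite (F z) \<and> card (F z) \<le> 2" if z: "z \<in> nbhd ?H v" for z
  proof (cases "z \<in> N")
    case True
    then have "v \<in> \<tau> z"
      using z v packing_disjoint_verts graph_edgeD(2)[OF graph]
      by (fastforce simp: nbhd_def edge_replace_iff)
    moreover have "card (\<tau> z) = 3"
      using True packing by (auto simp: triangle_packing_def triangle_def)
    ultimately show ?thesis
      using True by (simp add: F_def card.infinite card_ge_0_finite)
  qed (simp add: F_def)
  have "nbhd G v \<subseteq> (\<Union>z\<in>nbhd ?H v. F z)"
  proof
    fix w assume w: "w \<in> nbhd G v"
    then have wG: "{v, w} \<in> edges G"
      by (simp add: nbhd_def)
    show "w \<in> (\<Union>z\<in>nbhd ?H v. F z)"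
    proof (cases "\<exists>y\<in>N. {v, w} \<in> pairs (\<tau> y)")
      case True
      then obtain y where "y \<in> N" "v \<in> \<tau> y" "w \<in> \<tau> y" "v \<noteq> w"
        by (auto simp: doubleton_in_pairs_iff)
      then have "y \<in> nbhd ?H v" "w \<in> F y"
        by (auto simp: nbhd_def edge_replace_iff F_def)
      then show ?thesis by blast
    next
      case False
      then have "w \<in> nbhd ?H v"
        using wG by (auto simp: nbhd_def edge_replace_iff)
      moreover have "w \<in> F w"
        using graph_edgeD(2)[OF graph wG] packing_disjoint_verts by (auto simp: F_def)
      ultimately show ?thesis by blast
    qed
  qed
  then have "degree G v \<le> card (\<Union>z\<in>nbhd ?H v. F z)"
    unfolding degree_def using fin F by (intro card_mono) auto
  also have "\<dots> \<le> (\<Sum>z\<in>nbhd ?H v. card (F z))"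
    by (rule card_UN_le[OF fin])
  also have "\<dots> \<le> of_nat (card (nbhd ?H v)) * 2"
    using F by (intro sum_bounded_above) auto
  finally show ?thesis
    by (simp add: degree_def)
qed

lemma triangle_packing_insert:
  assumes T: "triangle (replace_triangles G N \<tau>) T" and y: "y \<notin> verts G \<union> N"
  shows "triangle_packing G (insert y N) (\<tau>(y := T))"
proof -
  let ?H = "replace_triangles G N \<tau>"
  have sub: "T \<subseteq> verts G \<union> N" and card: "card T = 3" and edges: "pairs T \<subseteq> edges ?H"
    using T by (auto simp: triangle_def)
  have "T \<inter> N = {}"
  proof (rule ccontr)
    assume "T \<inter> N \<noteq> {}"
    then obtain z where z: "z \<in> T" "z \<in> N" by blast
    then have "card (T - {z}) = 2"
      using card by (simp add: card_ge_0_finite)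
    then obtain a b where ab: "T - {z} = {a, b}" "a \<noteq> b"
      by (meson card_2_iff)
    then have "{z, a} \<in> pairs T" "{z, b} \<in> pairs T" "{a, b} \<in> pairs T"
      using z by (auto simp: doubleton_in_pairs_iff)
    then have "a \<in> nbhd ?H z" "b \<in> nbhd ?H z" "{a, b} \<in> edges ?H"
      using edges by (auto simp: nbhd_def)
    then show False
      using independent_replace_new[OF z(2)] nbhd_replace_new[OF z(2)]
      by (auto simp: independent_def)
  qed
  then have old: "e \<in> edges G \<and> (\<forall>z\<in>N. e \<notin> pairs (\<tau> z))" if "e \<in> pairs T" for e
  proof -
    obtain a b where ab: "e = {a, b}" "a \<in> T" "b \<in> T"
      using \<open>e \<in> pairs T\<close> by (auto simp: pairs_def)
    moreover have "e \<in> edges ?H"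
      using that edges by blast
    ultimately show ?thesis
      using \<open>T \<inter> N = {}\<close> by (auto simp: edge_replace_iff)
  qed
  then have "triangle G T"
    using sub card \<open>T \<inter> N = {}\<close> by (auto simp: triangle_def)
  moreover have "pairs T \<inter> pairs (\<tau> z) = {}" "pairs (\<tau> z) \<inter> pairs T = {}" if "z \<in> N" for z
    using old that by blast+
  ultimately show ?thesis
    using packing y by (simp add: triangle_packing_def)
qed

lemma delta_Y_replace:
  assumes T: "triangle (replace_triangles G N \<tau>) T" and y: "y \<notin> verts G \<union> N"
  shows "delta_Y (replace_triangles G N \<tau>) T y =
    replace_triangles G (insert y N) (\<tau>(y := T))"
proof -
  have new: "triangle_packing G (insert y N) (\<tau>(y := T))"
    by (rule triangle_packing_insert[OF T y])
  then have TG: "T \<subseteq> verts G"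
    by (auto simp: triangle_packing_def triangle_def)
  have "{z, v} \<notin> pairs T" if "z \<in> N" for z v
    using that TG packing_disjoint_verts by (auto simp: doubleton_in_pairs_iff)
  then have disj: "pairs T \<inter> {{z, v} | z v. z \<in> N \<and> v \<in> \<tau> z} = {}"
    by blast
  have removed: "(\<Union>z\<in>insert y N. pairs ((\<tau>(y := T)) z)) = pairs T \<union> (\<Union>z\<in>N. pairs (\<tau> z))"
    using y by (auto split: if_splits)
  have added: "{{z, v} | z v. z \<in> insert y N \<and> v \<in> (\<tau>(y := T)) z} =
      {{z, v} | z v. z \<in> N \<and> v \<in> \<tau> z} \<union> {{y, v} | v. v \<in> T}"
    using y by auto
  have "(A - B \<union> C) - P \<union> D = A - (P \<union> B) \<union> (C \<union> D)" if "P \<inter> C = {}"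
    for A B C D P :: "'a set set"
    using that by blast
  from this[OF disj]
  have "edges (replace_triangles G N \<tau>) - pairs T \<union> {{y, v} | v. v \<in> T} =
      edges (replace_triangles G (insert y N) (\<tau>(y := T)))"
    unfolding edges_replace removed added .
  then show ?thesis
    by (simp add: delta_Y_def replace_triangles_def)
qed

lemma triangle_packing_remove: "triangle_packing G (N - {y}) \<tau>"
  using packing by (auto simp: triangle_packing_def)

text \<open>Edge-disjointness ensures that no edge of the restored triangle stays deleted.\<close>

lemma Y_delta_replace:
  assumes y: "y \<in> N"
  shows "Y_delta (replace_triangles G N \<tau>) y = replace_triangles G (N - {y}) \<tau>"
proof -
  let ?H = "replace_triangles G N \<tau>"
  have disj: "pairs (\<tau> y) \<inter> pairs (\<tau> z) = {}" if "z \<in> N - {y}" for z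
    using that y packing unfolding triangle_packing_def by blast
  have tri: "pairs (\<tau> y) \<subseteq> edges G"
    using y packing by (auto simp: triangle_packing_def triangle_def)
  have yG: "y \<notin> e" if "e \<in> edges G" for e
    using that packing_disjoint_verts[OF y] by (auto elim: graph_edge_cases[OF graph])
  \<comment> \<open>the end \<open>v\<close> of an edge of another Y is a vertex of \<open>G\<close>, hence not \<open>y\<close>\<close>
  have yN: "y \<notin> {z, v} \<longleftrightarrow> z \<noteq> y" if "z \<in> N" "v \<in> \<tau> z" for z v
    using that packing_subset[of z] packing_disjoint_verts[OF y] by auto
  have "{e \<in> edges ?H. y \<notin> e} \<union> pairs (\<tau> y) = edges (replace_triangles G (N - {y}) \<tau>)"
  proof -
    have kept: "{e \<in> edges ?H. y \<notin> e} =
        (edges G - (\<Union>z\<in>N. pairs (\<tau> z))) \<union> {{z, v} | z v. z \<in> N - {y} \<and> v \<in> \<tau> z}"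
      unfolding edges_replace using yG yN by blast
    have restored: "edges G - (\<Union>z\<in>N. pairs (\<tau> z)) \<union> pairs (\<tau> y) =
        edges G - (\<Union>z\<in>N - {y}. pairs (\<tau> z))"
      using tri disj y by blast
    show ?thesis
      unfolding kept unfolding edges_replace restored[symmetric] by (simp only: Un_ac)
  qed
  moreover have "verts ?H - {y} = verts (replace_triangles G (N - {y}) \<tau>)"
    using packing_disjoint_verts[OF y] by auto
  ultimately show ?thesis
    unfolding Y_delta_def nbhd_replace_new[OF y] by (simp add: replace_triangles_def)
qed

lemma strong_Y_delta_at_replace:
  assumes deg: "\<forall>v\<in>verts G. degree G v \<ge> 7"
    and x: "Y_delta_at (replace_triangles G N \<tau>) x"
  shows "x \<in> N" and "strong_Y_delta_at (replace_triangles G N \<tau>) x"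
proof -
  show xN: "x \<in> N"
  proof (rule ccontr)
    assume "x \<notin> N"
    then have "x \<in> verts G" and "degree (replace_triangles G N \<tau>) x = 3"
      using x by (auto simp: Y_delta_at_def)
    then show False
      using deg degree_le_twice_degree_replace[of x] by force
  qed
  show "strong_Y_delta_at (replace_triangles G N \<tau>) x"
    using x independent_replace_new[OF xN] nbhd_replace_new[OF xN]
    by (simp add: strong_Y_delta_at_def Y_delta_at_def degree_def)
qed

end

section \<open>Graphs obtainable by moves\<close>

text \<open>
  The triangle-replacement description, by induction along a sequence of moves. The statement
  about \<open>U\<close> is needed because a fresh name is only known to lie outside \<open>U\<close>.
\<close>

lemma obtainable_imp_strong_and_replace:
  assumes graph: "graph G" and deg: "\<forall>v\<in>verts G. degree G v \<ge> 7"
    and "obtainable Y_delta_at G U H"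
  shows "obtainable strong_Y_delta_at G U H \<and> verts H \<subseteq> U \<and> verts G \<subseteq> U \<and>
    (\<exists>N \<tau>. triangle_packing G N \<tau> \<and> H = replace_triangles G N \<tau>)"
  using assms(3)
proof (induction rule: obtainable.induct)
  case start
  have "triangle_packing G {} (\<lambda>_. {}) \<and> G = replace_triangles G {} (\<lambda>_. {})"
    by (simp add: triangle_packing_def replace_triangles_empty)
  then show ?case
    using obtainable.start by blast
next
  case (delta_Y U H T y)
  then obtain N \<tau> where N: "triangle_packing G N \<tau>" and H: "H = replace_triangles G N \<tau>"
    by blast
  have y: "y \<notin> verts G \<union> N"
    using delta_Y H by auto
  have T: "triangle (replace_triangles G N \<tau>) T"
    using delta_Y H by simp
  have "\<exists>N \<tau>. triangle_packing G N \<tau> \<and> delta_Y H T y = replace_triangles G N \<tau>"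
    using triangle_packing_insert[OF graph N T y] delta_Y_replace[OF graph N T y] H by blast
  moreover have "verts (delta_Y H T y) \<subseteq> insert y U"
    using delta_Y by (auto simp: delta_Y_def)
  ultimately show ?case
    using delta_Y obtainable.delta_Y[of strong_Y_delta_at G U H T y] by blast
next
  case (Y_delta U H x)
  then obtain N \<tau> where N: "triangle_packing G N \<tau>" and H: "H = replace_triangles G N \<tau>"
    by blast
  have x: "x \<in> N" "strong_Y_delta_at H x"
    using strong_Y_delta_at_replace[OF graph N deg] Y_delta H by auto
  have "\<exists>N \<tau>. triangle_packing G N \<tau> \<and> Y_delta H x = replace_triangles G N \<tau>"
    using triangle_packing_remove[OF graph N] Y_delta_replace[OF graph N x(1)] H by blast
  moreover have "verts (Y_delta H x) \<subseteq> U"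
    using Y_delta by (auto simp: Y_delta_def)
  ultimately show ?case
    using Y_delta x(2) obtainable.Y_delta[of strong_Y_delta_at G U H x] by blast
qed

lemma obtainable_mono:
  assumes "obtainable P G U H" and "\<And>H x. P H x \<Longrightarrow> Q H x"
  shows "obtainable Q G U H"
  using assms(1) by induction (auto intro: obtainable.intros assms(2))

section \<open>Invariance under renaming\<close>

lemma strong_Y_delta_at_renaming:
  assumes ren: "(H, H') \<in> renaming G"
    and strong: "\<And>x. Y_delta_at H x \<Longrightarrow> strong_Y_delta_at H x"
    and x': "Y_delta_at H' x'"
  shows "strong_Y_delta_at H' x'"
proof -
  obtain f where g: "graph H" "graph H'" and b: "bij_betw f (verts H) (verts H')"
    and e: "edges H' = (\<lambda>e. f ` e) ` edges H"
    using ren by (auto simp: renaming_def)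
  have inj: "inj_on f (verts H)"
    using b by (rule bij_betw_imp_inj_on)
  have edge: "{f u, f v} \<in> edges H' \<longleftrightarrow> {u, v} \<in> edges H"
    if uv: "u \<in> verts H" "v \<in> verts H" for u v
  proof
    assume "{f u, f v} \<in> edges H'"
    then obtain d where d: "d \<in> edges H" "f ` {u, v} = f ` d"
      using e by auto
    moreover have "d \<subseteq> verts H"
      using d(1) g(1) by (auto simp: graph_def pairs_def)
    ultimately have "{u, v} = d"
      using inj_on_image_eq_iff[OF inj, of "{u, v}" d] uv by simp
    then show "{u, v} \<in> edges H"
      using d(1) by simp
  next
    assume "{u, v} \<in> edges H"
    then have "f ` {u, v} \<in> edges H'"
      unfolding e by (rule imageI)
    then show "{f u, f v} \<in> edges H'"
      by simp
  qed
  have surj: "f ` verts H = verts H'"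
    using b by (rule bij_betw_imp_surj_on)
  obtain x where x: "x \<in> verts H" "x' = f x"
    using x' surj by (auto simp: Y_delta_at_def)
  have sub: "nbhd H x \<subseteq> verts H"
    by (rule nbhd_subset_verts[OF g(1)])
  have nb: "nbhd H' x' = f ` nbhd H x"
  proof (intro equalityI subsetI)
    fix w assume "w \<in> nbhd H' x'"
    moreover from this obtain v where "v \<in> verts H" "w = f v"
      using nbhd_subset_verts[OF g(2)] surj by blast
    ultimately show "w \<in> f ` nbhd H x"
      using edge x by (auto simp: nbhd_def)
  next
    fix w assume "w \<in> f ` nbhd H x"
    then show "w \<in> nbhd H' x'"
      using edge x sub by (auto simp: nbhd_def)
  qed
  have card: "card (nbhd H' x') = card (nbhd H x)"
    unfolding nb by (rule card_image[OF inj_on_subset[OF inj sub]])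
  then have "strong_Y_delta_at H x"
    using x' x by (intro strong) (simp add: Y_delta_at_def degree_def)
  then have ind: "{u, v} \<notin> edges H" if "u \<in> nbhd H x" "v \<in> nbhd H x" for u v
    using that by (simp add: strong_Y_delta_at_def independent_def)
  have "{f u, f v} \<notin> edges H'" if "u \<in> nbhd H x" "v \<in> nbhd H x" for u v
    using ind[OF that] edge[of u v] that sub by blast
  then have "independent H' (nbhd H' x')"
    using nbhd_subset_verts[OF g(2), of x'] unfolding independent_def nb by simp
  then show ?thesis
    using x' by (simp add: strong_Y_delta_at_def Y_delta_at_def degree_def)
qed

section \<open>The two families\<close>

theorem lemma10:
  fixes G :: "'a::infinite ugraph"
  assumes "graph G" and "min_degree G \<ge> 7"
  shows "strong_family G = family G
    \<and> (\<forall>C\<in>family G. \<forall>H\<in>C.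
          (\<forall>x. Y_delta_at H x \<longrightarrow> strong_Y_delta_at H x)
        \<and> (\<forall>x\<in>verts H. degree H x = 3 \<longrightarrow>
             (\<forall>u\<in>nbhd H x. \<forall>v\<in>nbhd H x. u \<noteq> v \<longrightarrow> {u, v} \<notin> edges H)))"
proof -
  have deg: "\<forall>v\<in>verts G. degree G v \<ge> 7"
  proof
    fix v assume "v \<in> verts G"
    then have "min_degree G \<le> degree G v"
      using assms(1) by (auto simp: min_degree_def graph_def intro: Min_le)
    then show "degree G v \<ge> 7"
      using assms(2) by simp
  qed
  note obt = obtainable_imp_strong_and_replace[OF assms(1) deg]
  have "obtainable strong_Y_delta_at G U H \<longleftrightarrow> obtainable Y_delta_at G U H" for U H
    using obt obtainable_mono[of strong_Y_delta_at G U H Y_delta_at]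
    by (auto simp: strong_Y_delta_at_def)
  then have fam: "strong_family G = family G"
    by (simp add: strong_family_def family_def)
  have strong: "strong_Y_delta_at H x"
    if C: "C \<in> family G" "H \<in> C" and x: "Y_delta_at H x" for C H x
  proof -
    obtain H0 U where H0: "obtainable Y_delta_at G U H0" and ren: "(H0, H) \<in> renaming G"
      using C by (auto simp: family_def quotient_def)
    obtain N \<tau> where N: "triangle_packing G N \<tau>" and H0N: "H0 = replace_triangles G N \<tau>"
      using obt[OF H0] by blast
    show ?thesis
      using strong_Y_delta_at_renaming[OF ren _ x]
        strong_Y_delta_at_replace(2)[OF assms(1) N deg] H0N by blast
  qed
  then have "{u, v} \<notin> edges H"
    if "C \<in> family G" "H \<in> C" "x \<in> verts H" "degree H x = 3" "u \<in> nbhd H x" "v \<in> nbhd H x"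
    for C H x u v
    using that by (metis Y_delta_at_def strong_Y_delta_at_def independent_def)
  then show ?thesis
    using fam strong by blast
qed

end
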